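(* OBFOL is incomparable in expressive power with the clique-guarded fragment CGFOL and with the guarded-negation fragment GNFOL: there exists an OBFOL sentence that is equivalent to no CGFOL sentence and to no GNFOL sentence, and there exists a sentence belonging to both CGFOL and GNFOL (indeed a guarded sentence) that is equivalent to no OBFOL sentence.
   Context: Language signature $\Sigma=(\mathrm{Args},\mathrm{Rels},\mathrm{ar})$: $\mathrm{Args},\mathrm{Rels}$ finite non-empty, $\mathrm{ar}:\mathrm{Rels}\to\mathcal P(\mathrm{Args})\setminus\{\emptyset\}$. A $\Sigma$-structure $\mathcal R=(D,\cdot^{\mathcal R})$: $D$ non-empty, $r^{\mathcal R}$ a set of functions $\mathrm{ar}(r)\to D$. FOL formulas: $\varphi::= r\mid\neg\varphi\mid\varphi\wedge\varphi\mid\varphi\vee\varphi\mid\exists x.\varphi\mid\forall x.\varphi\mid(a,x)\varphi$, with semantics over partial assignments $\chi:\mathrm{Args}\cup\mathrm{Var}\rightharpoonup D$: $\mathcal R,\chi\models r$ iff $\chi|_{\mathrm{ar}(r)}\in r^{\mathcal R}$, usual Boolean/quantifier clauses, $\mathcal R,\chi\models(a,x)\varphi$ iff $\mathcal R,\chi[a\mapsto\chi(x)]\models\varphi$; a sentence has no free arguments or variables, and $\mathcal R\models\varphi$ iff $\mathcal R,\emptyset\models\varphi$. Fixing an order on the arguments of each relation, such formulas correspond exactly to classical relational first-order formulas ($(a_1,x_1)\cdots(a_m,x_m)r$ corresponds to $r(x_1,\dots,x_m)$), and conversely; equivalence of sentences means having the same models. Quantification prefix: finite word over $\{\exists x,\forall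 x\}$, each variable at most once; binding prefix: finite word over pairs $(a,x)$, each argument at most once; derived relation: Boolean combination of relations all with the same argument set. OBFOL formulas: $\varphi::=\wp\flat\bar r\mid(\varphi\wedge\varphi)\mid(\varphi\vee\varphi)$. CGFOL is the clique-guarded fragment of first-order logic (Grädel): quantification only of the form $\exists\bar y(\gamma(\bar x,\bar y)\wedge\phi)$ / $\forall\bar y(\gamma(\bar x,\bar y)\to\phi)$ where $\gamma$ is a clique-formula (an existentially quantified conjunction of atoms in which every two of its free variables co-occur in some atom) whose free variables include all free variables of $\phi$; it contains the guarded fragment, where $\gamma$ is a single atom. GNFOL is the guarded-negation fragment (Bárány, ten Cate, Segoufin): $\phi::=R(\bar x)\mid x=y\mid\exists x\phi\mid\phi\wedge\phi\mid\phi\vee\phi\mid\alpha\wedge\neg\phi$, with $\alpha$ an atomic formula containing all free variables of $\phi$. *)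

theory Defs
  imports Main
begin

section \<open>Signatures and structures\<close>

type_synonym var = nat

record ('a, 'r) signature =
  args :: "'a set"
  rels :: "'r set"
  ar :: "'r \<Rightarrow> 'a set"

definition wf_signature :: "('a, 'r) signature \<Rightarrow> bool" where
  "wf_signature S \<longleftrightarrow>
     finite (args S) \<and> args S \<noteq> {} \<and> finite (rels S) \<and> rels S \<noteq> {} \<and>
     (\<forall>r \<in> rels S. ar S r \<subseteq> args S \<and> ar S r \<noteq> {})"

text \<open>A relation is a set of functions from \<open>ar S r\<close> to the universe; such a function is
  represented by a partial map whose domain is exactly \<open>ar S r\<close>.\<close>

record ('a, 'r, 'd) rel_structure =
  universe :: "'d set"
  interp :: "'r \<Rightarrow> ('a \<rightharpoonup> 'd) set"

definition is_structure :: "('a, 'r) signature \<Rightarrow> ('a, 'r, 'd) rel_structure \<Rightarrow> bool" where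
  "is_structure S R \<longleftrightarrow>
     universe R \<noteq> {} \<and>
     (\<forall>r \<in> rels S. \<forall>f \<in> interp R r. dom f = ar S r \<and> ran f \<subseteq> universe R)"

section \<open>First-order logic with binding forms\<close>

datatype ('a, 'r) fml =
    Rel 'r
  | Neg "('a, 'r) fml"
  | And "('a, 'r) fml" "('a, 'r) fml"
  | Or "('a, 'r) fml" "('a, 'r) fml"
  | Ex var "('a, 'r) fml"
  | All var "('a, 'r) fml"
  | Bind 'a var "('a, 'r) fml"

fun over_sig :: "('a, 'r) signature \<Rightarrow> ('a, 'r) fml \<Rightarrow> bool" where
  "over_sig S (Rel r) = (r \<in> rels S)"
| "over_sig S (Neg \<phi>) = over_sig S \<phi>"
| "over_sig S (And \<phi> \<psi>) = (over_sig S \<phi> \<and> over_sig S \<psi>)"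
| "over_sig S (Or \<phi> \<psi>) = (over_sig S \<phi> \<and> over_sig S \<psi>)"
| "over_sig S (Ex x \<phi>) = over_sig S \<phi>"
| "over_sig S (All x \<phi>) = over_sig S \<phi>"
| "over_sig S (Bind a x \<phi>) = (a \<in> args S \<and> over_sig S \<phi>)"

text \<open>Free arguments are tagged \<open>Inl\<close>, free variables \<open>Inr\<close>. A binding \<open>(a, x)\<close> of an argument
  that is not free in \<open>\<phi>\<close> has no effect and does not make \<open>x\<close> free.\<close>

fun free :: "('a, 'r) signature \<Rightarrow> ('a, 'r) fml \<Rightarrow> ('a + var) set" where
  "free S (Rel r) = Inl ` ar S r"
| "free S (Neg \<phi>) = free S \<phi>"
| "free S (And \<phi> \<psi>) = free S \<phi> \<union> free S \<psi>"
| "free S (Or \<phi> \<psi>) = free S \<phi> \<union> free S \<psi>"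
| "free S (Ex x \<phi>) = free S \<phi> - {Inr x}"
| "free S (All x \<phi>) = free S \<phi> - {Inr x}"
| "free S (Bind a x \<phi>) =
     (if Inl a \<in> free S \<phi> then (free S \<phi> - {Inl a}) \<union> {Inr x} else free S \<phi>)"

definition sentence :: "('a, 'r) signature \<Rightarrow> ('a, 'r) fml \<Rightarrow> bool" where
  "sentence S \<phi> \<longleftrightarrow> over_sig S \<phi> \<and> free S \<phi> = {}"

fun sat :: "('a, 'r) signature \<Rightarrow> ('a, 'r, 'd) rel_structure \<Rightarrow> ('a + var \<rightharpoonup> 'd) \<Rightarrow> ('a, 'r) fml \<Rightarrow> bool" where
  "sat S R \<chi> (Rel r) = ((\<lambda>a. \<chi> (Inl a)) |` ar S r \<in> interp R r)"
| "sat S R \<chi> (Neg \<phi>) = (\<not> sat S R \<chi> \<phi>)"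
| "sat S R \<chi> (And \<phi> \<psi>) = (sat S R \<chi> \<phi> \<and> sat S R \<chi> \<psi>)"
| "sat S R \<chi> (Or \<phi> \<psi>) = (sat S R \<chi> \<phi> \<or> sat S R \<chi> \<psi>)"
| "sat S R \<chi> (Ex x \<phi>) = (\<exists>d \<in> universe R. sat S R (\<chi>(Inr x \<mapsto> d)) \<phi>)"
| "sat S R \<chi> (All x \<phi>) = (\<forall>d \<in> universe R. sat S R (\<chi>(Inr x \<mapsto> d)) \<phi>)"
| "sat S R \<chi> (Bind a x \<phi>) = sat S R (\<chi>(Inl a := \<chi> (Inr x))) \<phi>"

definition models :: "('a, 'r) signature \<Rightarrow> ('a, 'r, 'd) rel_structure \<Rightarrow> ('a, 'r) fml \<Rightarrow> bool" where
  "models S R \<phi> \<longleftrightarrow> sat S R Map.empty \<phi>"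

section \<open>The one-binding fragment\<close>

datatype quantifier = Exists | Forall

fun quantify :: "quantifier \<times> var \<Rightarrow> ('a, 'r) fml \<Rightarrow> ('a, 'r) fml" where
  "quantify (Exists, x) \<phi> = Ex x \<phi>"
| "quantify (Forall, x) \<phi> = All x \<phi>"

definition quant_prefix :: "(quantifier \<times> var) list \<Rightarrow> ('a, 'r) fml \<Rightarrow> ('a, 'r) fml" where
  "quant_prefix qs \<phi> = foldr quantify qs \<phi>"

definition bind_prefix :: "('a \<times> var) list \<Rightarrow> ('a, 'r) fml \<Rightarrow> ('a, 'r) fml" where
  "bind_prefix bs \<phi> = foldr (\<lambda>(a, x). Bind a x) bs \<phi>"

inductive derived_rel :: "('a, 'r) signature \<Rightarrow> 'a set \<Rightarrow> ('a, 'r) fml \<Rightarrow> bool"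
  for S :: "('a, 'r) signature" and A :: "'a set" where
  "r \<in> rels S \<Longrightarrow> ar S r = A \<Longrightarrow> derived_rel S A (Rel r)"
| "derived_rel S A \<phi> \<Longrightarrow> derived_rel S A (Neg \<phi>)"
| "derived_rel S A \<phi> \<Longrightarrow> derived_rel S A \<psi> \<Longrightarrow> derived_rel S A (And \<phi> \<psi>)"
| "derived_rel S A \<phi> \<Longrightarrow> derived_rel S A \<psi> \<Longrightarrow> derived_rel S A (Or \<phi> \<psi>)"

inductive obfol :: "('a, 'r) signature \<Rightarrow> ('a, 'r) fml \<Rightarrow> bool"
  for S :: "('a, 'r) signature" where
  "distinct (map snd qs) \<Longrightarrow> distinct (map fst bs) \<Longrightarrow> fst ` set bs \<subseteq> args S \<Longrightarrow>
     derived_rel S A \<rho> \<Longrightarrow> obfol S (quant_prefix qs (bind_prefix bs \<rho>))"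
| "obfol S \<phi> \<Longrightarrow> obfol S \<psi> \<Longrightarrow> obfol S (And \<phi> \<psi>)"
| "obfol S \<phi> \<Longrightarrow> obfol S \<psi> \<Longrightarrow> obfol S (Or \<phi> \<psi>)"

section \<open>Classical relational first-order logic with equality\<close>

datatype 'r cfml =
    CRel 'r "var list"
  | CEq var var
  | CNeg "'r cfml"
  | CAnd "'r cfml" "'r cfml"
  | COr "'r cfml" "'r cfml"
  | CImp "'r cfml" "'r cfml"
  | CEx var "'r cfml"
  | CAll var "'r cfml"

fun cover_sig :: "('a, 'r) signature \<Rightarrow> 'r cfml \<Rightarrow> bool" where
  "cover_sig S (CRel r xs) = (r \<in> rels S \<and> length xs = card (ar S r))"
| "cover_sig S (CEq x y) = True"
| "cover_sig S (CNeg \<phi>) = cover_sig S \<phi>"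
| "cover_sig S (CAnd \<phi> \<psi>) = (cover_sig S \<phi> \<and> cover_sig S \<psi>)"
| "cover_sig S (COr \<phi> \<psi>) = (cover_sig S \<phi> \<and> cover_sig S \<psi>)"
| "cover_sig S (CImp \<phi> \<psi>) = (cover_sig S \<phi> \<and> cover_sig S \<psi>)"
| "cover_sig S (CEx x \<phi>) = cover_sig S \<phi>"
| "cover_sig S (CAll x \<phi>) = cover_sig S \<phi>"

fun cfree :: "'r cfml \<Rightarrow> var set" where
  "cfree (CRel r xs) = set xs"
| "cfree (CEq x y) = {x, y}"
| "cfree (CNeg \<phi>) = cfree \<phi>"
| "cfree (CAnd \<phi> \<psi>) = cfree \<phi> \<union> cfree \<psi>"
| "cfree (COr \<phi> \<psi>) = cfree \<phi> \<union> cfree \<psi>"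
| "cfree (CImp \<phi> \<psi>) = cfree \<phi> \<union> cfree \<psi>"
| "cfree (CEx x \<phi>) = cfree \<phi> - {x}"
| "cfree (CAll x \<phi>) = cfree \<phi> - {x}"

definition csentence :: "('a, 'r) signature \<Rightarrow> 'r cfml \<Rightarrow> bool" where
  "csentence S \<phi> \<longleftrightarrow> cover_sig S \<phi> \<and> cfree \<phi> = {}"

fun equality_free :: "'r cfml \<Rightarrow> bool" where
  "equality_free (CRel r xs) = True"
| "equality_free (CEq x y) = False"
| "equality_free (CNeg \<phi>) = equality_free \<phi>"
| "equality_free (CAnd \<phi> \<psi>) = (equality_free \<phi> \<and> equality_free \<psi>)"
| "equality_free (COr \<phi> \<psi>) = (equality_free \<phi> \<and> equality_free \<psi>)"
| "equality_free (CImp \<phi> \<psi>) = (equality_free \<phi> \<and> equality_free \<psi>)"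
| "equality_free (CEx x \<phi>) = equality_free \<phi>"
| "equality_free (CAll x \<phi>) = equality_free \<phi>"

text \<open>The positions of a classical atom are the arguments of the relation in increasing order:
  \<open>r(x\<^sub>1, \<dots>, x\<^sub>m)\<close> gives the value of \<open>x\<^sub>i\<close> to the \<open>i\<close>-th argument of \<open>r\<close>.\<close>

definition arg_list :: "('a::linorder, 'r) signature \<Rightarrow> 'r \<Rightarrow> 'a list" where
  "arg_list S r = sorted_list_of_set (ar S r)"

fun csat :: "('a::linorder, 'r) signature \<Rightarrow> ('a, 'r, 'd) rel_structure \<Rightarrow> (var \<rightharpoonup> 'd) \<Rightarrow> 'r cfml \<Rightarrow> bool" where
  "csat S R \<chi> (CRel r xs) = (\<chi> \<circ>\<^sub>m map_of (zip (arg_list S r) xs) \<in> interp R r)"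
| "csat S R \<chi> (CEq x y) = (\<chi> x = \<chi> y)"
| "csat S R \<chi> (CNeg \<phi>) = (\<not> csat S R \<chi> \<phi>)"
| "csat S R \<chi> (CAnd \<phi> \<psi>) = (csat S R \<chi> \<phi> \<and> csat S R \<chi> \<psi>)"
| "csat S R \<chi> (COr \<phi> \<psi>) = (csat S R \<chi> \<phi> \<or> csat S R \<chi> \<psi>)"
| "csat S R \<chi> (CImp \<phi> \<psi>) = (csat S R \<chi> \<phi> \<longrightarrow> csat S R \<chi> \<psi>)"
| "csat S R \<chi> (CEx x \<phi>) = (\<exists>d \<in> universe R. csat S R (\<chi>(x \<mapsto> d)) \<phi>)"
| "csat S R \<chi> (CAll x \<phi>) = (\<forall>d \<in> universe R. csat S R (\<chi>(x \<mapsto> d)) \<phi>)"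

definition cmodels :: "('a::linorder, 'r) signature \<Rightarrow> ('a, 'r, 'd) rel_structure \<Rightarrow> 'r cfml \<Rightarrow> bool" where
  "cmodels S R \<phi> \<longleftrightarrow> csat S R Map.empty \<phi>"

text \<open>The correspondence between \<open>(a\<^sub>1, x\<^sub>1) \<dots> (a\<^sub>m, x\<^sub>m) r\<close> and \<open>r(x\<^sub>1, \<dots>, x\<^sub>m)\<close>.\<close>

lemma sat_bind_prefix:
  assumes "distinct (map fst bs)"
  shows "sat S R \<chi> (bind_prefix bs \<phi>) =
    sat S R (case_sum (\<lambda>a. case map_of bs a of None \<Rightarrow> \<chi> (Inl a) | Some x \<Rightarrow> \<chi> (Inr x))
                      (\<lambda>x. \<chi> (Inr x))) \<phi>"
  using assms
proof (induction bs arbitrary: \<chi>)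
  case Nil
  have "case_sum (\<lambda>a. case map_of [] a of None \<Rightarrow> \<chi> (Inl a) | Some x \<Rightarrow> \<chi> (Inr x)) (\<lambda>x. \<chi> (Inr x)) = \<chi>"
    by (rule ext) (simp split: sum.split)
  then show ?case by (simp only: bind_prefix_def foldr.simps id_apply)
next
  case (Cons b bs)
  obtain a x where b: "b = (a, x)" by (cases b)
  have a: "map_of bs a = None"
    using Cons.prems b by (auto simp: map_of_eq_None_iff)
  let ?\<chi> = "\<chi>(Inl a := \<chi> (Inr x))"
  have "sat S R \<chi> (bind_prefix (b # bs) \<phi>) = sat S R ?\<chi> (bind_prefix bs \<phi>)"
    by (simp add: bind_prefix_def b)
  also have "\<dots> = sat S R (case_sum (\<lambda>a. case map_of bs a of None \<Rightarrow> ?\<chi> (Inl a) | Some x \<Rightarrow> ?\<chi> (Inr x))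
                      (\<lambda>x. ?\<chi> (Inr x))) \<phi>"
    by (rule Cons.IH) (use Cons.prems in simp)
  also have "case_sum (\<lambda>a. case map_of bs a of None \<Rightarrow> ?\<chi> (Inl a) | Some x \<Rightarrow> ?\<chi> (Inr x)) (\<lambda>x. ?\<chi> (Inr x))
     = case_sum (\<lambda>a. case map_of (b # bs) a of None \<Rightarrow> \<chi> (Inl a) | Some x \<Rightarrow> \<chi> (Inr x)) (\<lambda>x. \<chi> (Inr x))"
    using a by (auto simp: fun_eq_iff b split: sum.split option.split)
  finally show ?case .
qed

lemma sat_atom_iff_csat:
  assumes "wf_signature S" "r \<in> rels S" "length xs = card (ar S r)"
  shows "sat S R \<chi> (bind_prefix (zip (arg_list S r) xs) (Rel r)) \<longleftrightarrow>
         csat S R (\<lambda>x. \<chi> (Inr x)) (CRel r xs)"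
proof -
  have fin: "finite (ar S r)"
    using assms by (meson finite_subset wf_signature_def)
  let ?m = "map_of (zip (arg_list S r) xs)"
  have dist: "distinct (map fst (zip (arg_list S r) xs))"
    using fin assms(3) by (simp add: arg_list_def)
  have dom: "dom ?m = ar S r"
    using fin assms(3) by (simp add: arg_list_def)
  have "(\<lambda>a. case ?m a of None \<Rightarrow> \<chi> (Inl a) | Some x \<Rightarrow> \<chi> (Inr x)) |` ar S r = (\<lambda>x. \<chi> (Inr x)) \<circ>\<^sub>m ?m"
    unfolding dom[symmetric]
    by (auto simp: fun_eq_iff restrict_map_def map_comp_def split: option.split)
  then show ?thesis
    by (simp add: sat_bind_prefix[OF dist])
qed

section \<open>Guarded and clique-guarded fragments\<close>

fun is_atom :: "'r cfml \<Rightarrow> bool" where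
  "is_atom (CRel r xs) = True"
| "is_atom (CEq x y) = True"
| "is_atom _ = False"

definition cexs :: "var list \<Rightarrow> 'r cfml \<Rightarrow> 'r cfml" where
  "cexs ys \<phi> = foldr CEx ys \<phi>"

definition calls :: "var list \<Rightarrow> 'r cfml \<Rightarrow> 'r cfml" where
  "calls ys \<phi> = foldr CAll ys \<phi>"

inductive conj_of_atoms :: "'r cfml set \<Rightarrow> 'r cfml \<Rightarrow> bool" where
  "is_atom \<alpha> \<Longrightarrow> conj_of_atoms {\<alpha>} \<alpha>"
| "conj_of_atoms A \<phi> \<Longrightarrow> conj_of_atoms B \<psi> \<Longrightarrow> conj_of_atoms (A \<union> B) (CAnd \<phi> \<psi>)"

definition clique_formula :: "'r cfml \<Rightarrow> bool" where
  "clique_formula \<gamma> \<longleftrightarrow>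
     (\<exists>zs \<beta> A. \<gamma> = cexs zs \<beta> \<and> conj_of_atoms A \<beta> \<and>
        (\<forall>x \<in> cfree \<gamma>. \<forall>y \<in> cfree \<gamma>. \<exists>\<alpha> \<in> A. x \<in> cfree \<alpha> \<and> y \<in> cfree \<alpha>))"

text \<open>Formulas in which every quantifier block is relativised by a guard from \<open>G\<close>. The block
  \<open>ys\<close> consists of free variables of the guard, as the notation \<open>\<gamma>(x, y)\<close> for guards indicates.\<close>

inductive guarded_by :: "('r cfml \<Rightarrow> bool) \<Rightarrow> 'r cfml \<Rightarrow> bool"
  for G :: "'r cfml \<Rightarrow> bool" where
  "is_atom \<alpha> \<Longrightarrow> guarded_by G \<alpha>"
| "guarded_by G \<phi> \<Longrightarrow> guarded_by G (CNeg \<phi>)"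
| "guarded_by G \<phi> \<Longrightarrow> guarded_by G \<psi> \<Longrightarrow> guarded_by G (CAnd \<phi> \<psi>)"
| "guarded_by G \<phi> \<Longrightarrow> guarded_by G \<psi> \<Longrightarrow> guarded_by G (COr \<phi> \<psi>)"
| "guarded_by G \<phi> \<Longrightarrow> guarded_by G \<psi> \<Longrightarrow> guarded_by G (CImp \<phi> \<psi>)"
| "G \<gamma> \<Longrightarrow> set ys \<subseteq> cfree \<gamma> \<Longrightarrow> cfree \<phi> \<subseteq> cfree \<gamma> \<Longrightarrow> guarded_by G \<phi> \<Longrightarrow>
     guarded_by G (cexs ys (CAnd \<gamma> \<phi>))"
| "G \<gamma> \<Longrightarrow> set ys \<subseteq> cfree \<gamma> \<Longrightarrow> cfree \<phi> \<subseteq> cfree \<gamma> \<Longrightarrow> guarded_by G \<phi> \<Longrightarrow>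
     guarded_by G (calls ys (CImp \<gamma> \<phi>))"

definition gfol :: "'r cfml \<Rightarrow> bool" where
  "gfol = guarded_by is_atom"

definition cgfol :: "'r cfml \<Rightarrow> bool" where
  "cgfol = guarded_by clique_formula"

lemma is_atom_imp_clique_formula: "is_atom \<alpha> \<Longrightarrow> clique_formula \<alpha>"
  unfolding clique_formula_def
  by (rule exI[of _ "[]"], rule exI[of _ \<alpha>], rule exI[of _ "{\<alpha>}"])
     (auto simp: cexs_def intro: conj_of_atoms.intros)

lemma gfol_imp_cgfol: "gfol \<phi> \<Longrightarrow> cgfol \<phi>"
  unfolding gfol_def cgfol_def
  by (induction rule: guarded_by.induct)
     (auto intro: guarded_by.intros is_atom_imp_clique_formula)

section \<open>The guarded-negation fragment\<close>

inductive gnfol :: "'r cfml \<Rightarrow> bool" where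
  "gnfol (CRel r xs)"
| "gnfol (CEq x y)"
| "gnfol \<phi> \<Longrightarrow> gnfol (CEx x \<phi>)"
| "gnfol \<phi> \<Longrightarrow> gnfol \<psi> \<Longrightarrow> gnfol (CAnd \<phi> \<psi>)"
| "gnfol \<phi> \<Longrightarrow> gnfol \<psi> \<Longrightarrow> gnfol (COr \<phi> \<psi>)"
| "is_atom \<alpha> \<Longrightarrow> cfree \<phi> \<subseteq> cfree \<alpha> \<Longrightarrow> gnfol \<phi> \<Longrightarrow> gnfol (CAnd \<alpha> (CNeg \<phi>))"

section \<open>Equivalence\<close>

text \<open>The phantom argument selects the type from which universes are drawn. With \<open>nat\<close> these are,
  up to isomorphism, all countable structures; inequivalence over them implies inequivalence
  over structures of arbitrary cardinality (the converse being Loewenheim--Skolem).\<close>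

definition equivalent ::
  "'d itself \<Rightarrow> ('a::linorder, 'r) signature \<Rightarrow> ('a, 'r) fml \<Rightarrow> 'r cfml \<Rightarrow> bool" where
  "equivalent T S \<phi> \<psi> \<longleftrightarrow>
     (\<forall>R :: ('a, 'r, 'd) rel_structure. is_structure S R \<longrightarrow> (models S R \<phi> \<longleftrightarrow> cmodels S R \<psi>))"

end

(* Both separations use structures in which every relation holds of constant tuples only.

   If all constant tuples are present, every satisfied guard forces its free variables to take a
   single value, so CGFOL and GNFOL cannot tell a one-point universe from a two-point one, whereas
   "for all x, y: r(x, y)" holds in the former only.

   A matrix of an OBFOL formula mentions only relations with one and the same argument set. If r
   and p have different argument sets, an OBFOL sentence thus sees r and p only up to independent
   permutations of the universe, and cannot express that some x satisfies p(x) and r(x, x). *)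

theory Submission
  imports Defs
begin

section \<open>Structures of constant tuples\<close>

text \<open>A relation is coded by a set of points instead of a set of tuples, so that comparing two
  such structures over \<open>U\<close> reduces to a permutation of \<open>U\<close> taking each
  \<open>D r\<close> to its counterpart.\<close>

definition diag :: "('a, 'r) signature \<Rightarrow> 'd set \<Rightarrow> ('r \<Rightarrow> 'd set) \<Rightarrow> ('a, 'r, 'd) rel_structure" where
  "diag S U D = \<lparr>universe = U, interp = (\<lambda>r. (\<lambda>d. (\<lambda>_. Some d) |` ar S r) ` D r)\<rparr>"

lemma universe_diag [simp]: "universe (diag S U D) = U"
  by (simp add: diag_def)

lemma is_structure_diag:
  assumes "U \<noteq> {}" "\<And>r. r \<in> rels S \<Longrightarrow> D r \<subseteq> U"
  shows "is_structure S (diag S U D)"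
  using assms by (fastforce simp: is_structure_def diag_def ran_def restrict_map_def split: if_splits)

lemma mem_interp_diag:
  "f |` ar S r \<in> interp (diag S U D) r \<longleftrightarrow> (\<exists>d\<in>D r. \<forall>a\<in>ar S r. f a = Some d)"
  by (auto simp: diag_def image_iff fun_eq_iff restrict_map_def)

lemma sat_diag_Rel:
  "sat S (diag S U D) \<chi> (Rel r) \<longleftrightarrow> (\<exists>d\<in>D r. \<forall>a\<in>ar S r. \<chi> (Inl a) = Some d)"
  by (simp add: mem_interp_diag)

text \<open>Composing with a map from \<open>ar S r\<close> onto \<open>set xs\<close> preserves
  being constantly \<open>Some d\<close>, so neither the order of the positions nor a repetition of
  variables matters.\<close>

lemma csat_diag_CRel:
  assumes "wf_signature S" "r \<in> rels S" "length xs = card (ar S r)"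
  shows "csat S (diag S U D) \<chi> (CRel r xs) \<longleftrightarrow> (\<exists>d\<in>D r. \<forall>x\<in>set xs. \<chi> x = Some d)"
proof -
  have "finite (ar S r)"
    using assms by (meson finite_subset wf_signature_def)
  then have args: "length (arg_list S r) = length xs" "distinct (arg_list S r)"
      "set (arg_list S r) = ar S r"
    using assms(3) by (simp_all add: arg_list_def)
  define m where "m = map_of (zip (arg_list S r) xs)"
  have dom: "dom m = ar S r" and ran: "ran m = set xs"
    using args by (simp_all add: m_def ran_map_of_zip)
  \<comment> \<open>The composition is undefined outside \<open>ar S r\<close>, so inserting the
    restriction is harmless and brings the atom into the form of
    \<open>mem_interp_diag\<close>.\<close>
  have restrict: "(\<chi> \<circ>\<^sub>m m) |` ar S r = \<chi> \<circ>\<^sub>m m"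
    unfolding dom [symmetric]
    by (auto simp: fun_eq_iff restrict_map_def map_comp_def split: option.splits)
  have "csat S (diag S U D) \<chi> (CRel r xs) \<longleftrightarrow> (\<exists>d\<in>D r. \<forall>a\<in>ar S r. (\<chi> \<circ>\<^sub>m m) a = Some d)"
    using mem_interp_diag [of "\<chi> \<circ>\<^sub>m m" S r U D] unfolding restrict by (simp add: m_def)
  also have "\<dots> \<longleftrightarrow> (\<exists>d\<in>D r. \<forall>x\<in>set xs. \<chi> x = Some d)"
    unfolding dom [symmetric] ran [symmetric]
    by (auto simp: map_comp_def ran_def dom_def intro!: bex_cong split: option.splits)
  finally show ?thesis .
qed

section \<open>Guards in structures of all constant tuples\<close>

abbreviation full_diag :: "('a, 'r) signature \<Rightarrow> 'd set \<Rightarrow> ('a, 'r, 'd) rel_structure" where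
  "full_diag S U \<equiv> diag S U (\<lambda>_. U)"

text \<open>The value \<open>c\<close> is a parameter: on an empty \<open>X\<close>, as for a
  sentence, every \<open>c\<close> qualifies.\<close>

definition const_on :: "(var \<rightharpoonup> 'd) \<Rightarrow> 'd \<Rightarrow> var set \<Rightarrow> bool" where
  "const_on \<chi> c X \<longleftrightarrow> (\<forall>x\<in>X. \<chi> x = Some c)"

lemma const_on_subset: "const_on \<chi> c Y \<Longrightarrow> X \<subseteq> Y \<Longrightarrow> const_on \<chi> c X"
  by (auto simp: const_on_def)

lemma const_on_Un [simp]: "const_on \<chi> c (X \<union> Y) \<longleftrightarrow> const_on \<chi> c X \<and> const_on \<chi> c Y"
  by (auto simp: const_on_def)

lemma csat_full_diag_atom:
  assumes "wf_signature S" "is_atom \<alpha>" "cover_sig S \<alpha>" "const_on \<chi> c (cfree \<alpha>)" "c \<in> U"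
  shows "csat S (full_diag S U) \<chi> \<alpha>"
  using assms by (cases \<alpha>) (auto simp: csat_diag_CRel const_on_def simp del: csat.simps(1))

text \<open>A satisfied relational atom sits on a constant tuple, and a satisfied equality
  identifies its variables directly. Hence an atomic guard admits only assignments that are constant
  on its variables.\<close>

lemma csat_full_diag_atomD:
  assumes "wf_signature S" "is_atom \<alpha>" "cover_sig S \<alpha>" "csat S (full_diag S U) \<chi> \<alpha>"
    and "x \<in> cfree \<alpha>" "y \<in> cfree \<alpha>"
  shows "\<chi> x = \<chi> y"
  using assms by (cases \<alpha>) (auto simp: csat_diag_CRel simp del: csat.simps(1))

text \<open>Turns a block into a single choice of assignment. The list may repeat a variable; the
  innermost quantifier then decides its value.\<close>

lemma csat_cexs:
  "csat S R \<chi> (cexs ys \<phi>) \<longleftrightarrow>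
    (\<exists>\<chi>'. (\<forall>x. x \<notin> set ys \<longrightarrow> \<chi>' x = \<chi> x) \<and> (\<forall>y\<in>set ys. \<chi>' y \<in> Some ` universe R) \<and> csat S R \<chi>' \<phi>)"
proof (induction ys arbitrary: \<chi>)
  case Nil
  have "(\<forall>x. \<chi>' x = \<chi> x) \<longleftrightarrow> \<chi>' = \<chi>" for \<chi>' by auto
  then show ?case by (simp add: cexs_def)
next
  case (Cons z ys)
  have "csat S R \<chi> (cexs (z # ys) \<phi>) \<longleftrightarrow> (\<exists>d\<in>universe R. csat S R (\<chi>(z \<mapsto> d)) (cexs ys \<phi>))"
    by (simp add: cexs_def)
  also have "\<dots> \<longleftrightarrow> (\<exists>\<chi>'. (\<forall>x. x \<notin> set (z # ys) \<longrightarrow> \<chi>' x = \<chi> x) \<and>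
      (\<forall>y\<in>set (z # ys). \<chi>' y \<in> Some ` universe R) \<and> csat S R \<chi>' \<phi>)" (is "?L \<longleftrightarrow> ?R")
  proof
    assume ?L
    then obtain d \<chi>' where d: "d \<in> universe R" and
      \<chi>': "\<forall>x. x \<notin> set ys \<longrightarrow> \<chi>' x = (\<chi>(z \<mapsto> d)) x" "\<forall>y\<in>set ys. \<chi>' y \<in> Some ` universe R"
        "csat S R \<chi>' \<phi>"
      using Cons.IH by blast
    \<comment> \<open>If \<open>z\<close> is quantified again in \<open>ys\<close>, its value comes
      from there and not from \<open>d\<close>.\<close>
    have "\<chi>' z \<in> Some ` universe R"
      using d \<chi>'(1,2) by (cases "z \<in> set ys") auto
    then show ?R
      using \<chi>' by (intro exI [of _ \<chi>']) auto
  next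
    assume ?R
    then obtain \<chi>' where \<chi>': "\<forall>x. x \<notin> set (z # ys) \<longrightarrow> \<chi>' x = \<chi> x"
      "\<forall>y\<in>set (z # ys). \<chi>' y \<in> Some ` universe R" "csat S R \<chi>' \<phi>" by blast
    then obtain d where "d \<in> universe R" "\<chi>' z = Some d" by auto
    with \<chi>' show ?L
      by (intro bexI [of _ d]) (auto simp: Cons.IH intro!: exI [of _ \<chi>'])
  qed
  finally show ?case .
qed

text \<open>Duality, by which universal blocks inherit what is shown for existential ones.\<close>

lemma csat_calls: "csat S R \<chi> (calls ys \<phi>) \<longleftrightarrow> \<not> csat S R \<chi> (cexs ys (CNeg \<phi>))"
  by (induction ys arbitrary: \<chi>) (simp_all add: calls_def cexs_def)

lemma cover_sig_cexs [simp]: "cover_sig S (cexs ys \<phi>) = cover_sig S \<phi>"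
  by (induction ys) (simp_all add: cexs_def)

lemma cover_sig_calls [simp]: "cover_sig S (calls ys \<phi>) = cover_sig S \<phi>"
  by (induction ys) (simp_all add: calls_def)

lemma cfree_cexs [simp]: "cfree (cexs ys \<phi>) = cfree \<phi> - set ys"
  by (induction ys) (auto simp: cexs_def)

lemma cfree_calls [simp]: "cfree (calls ys \<phi>) = cfree \<phi> - set ys"
  by (induction ys) (auto simp: calls_def)

section \<open>Conjunctions of atoms and clique formulas\<close>

lemma csat_conj_of_atoms:
  "conj_of_atoms A \<beta> \<Longrightarrow> csat S R \<chi> \<beta> \<longleftrightarrow> (\<forall>\<alpha>\<in>A. csat S R \<chi> \<alpha>)"
  by (induction rule: conj_of_atoms.induct) auto

lemma cover_sig_conj_of_atoms:
  "conj_of_atoms A \<beta> \<Longrightarrow> cover_sig S \<beta> \<longleftrightarrow> (\<forall>\<alpha>\<in>A. cover_sig S \<alpha>)"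
  by (induction rule: conj_of_atoms.induct) auto

lemma cfree_conj_of_atoms: "conj_of_atoms A \<beta> \<Longrightarrow> cfree \<beta> = (\<Union>\<alpha>\<in>A. cfree \<alpha>)"
  by (induction rule: conj_of_atoms.induct) auto

lemma is_atom_conj_of_atoms: "conj_of_atoms A \<beta> \<Longrightarrow> \<alpha> \<in> A \<Longrightarrow> is_atom \<alpha>"
  by (induction rule: conj_of_atoms.induct) auto

lemma csat_full_diag_clique:
  assumes S: "wf_signature S" and clique: "clique_formula \<gamma>" and cover: "cover_sig S \<gamma>"
    and const: "const_on \<chi> c (cfree \<gamma>)" and c: "c \<in> U"
  shows "csat S (full_diag S U) \<chi> \<gamma>"
proof -
  obtain zs \<beta> A where \<gamma>: "\<gamma> = cexs zs \<beta>" and \<beta>: "conj_of_atoms A \<beta>"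
    using clique by (auto simp: clique_formula_def)
  \<comment> \<open>The bound variables of the clique formula receive \<open>c\<close> as well, so
    every atom of the matrix sees only the value \<open>c\<close>.\<close>
  define \<chi>' where "\<chi>' x = (if x \<in> set zs then Some c else \<chi> x)" for x
  have "const_on \<chi>' c (cfree \<beta>)"
    using const \<gamma> by (auto simp: const_on_def \<chi>'_def)
  then have "csat S (full_diag S U) \<chi>' \<beta>"
    using cover c unfolding csat_conj_of_atoms [OF \<beta>] \<gamma> cover_sig_cexs
      cover_sig_conj_of_atoms [OF \<beta>] cfree_conj_of_atoms [OF \<beta>]
    by (intro ballI csat_full_diag_atom [OF S is_atom_conj_of_atoms [OF \<beta>], where c = c])
      (auto intro: const_on_subset)
  then show ?thesis
    using c unfolding \<gamma> csat_cexs by (intro exI [of _ \<chi>']) (auto simp: \<chi>'_def)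
qed

text \<open>Some atom of the matrix contains both \<open>x\<close> and \<open>y\<close> and forces
  them to agree. Being free in \<open>\<gamma>\<close>, they are not among \<open>zs\<close>, so the
  witnesses for \<open>zs\<close> leave their values alone.\<close>

lemma csat_full_diag_cliqueD:
  assumes S: "wf_signature S" and clique: "clique_formula \<gamma>" and cover: "cover_sig S \<gamma>"
    and sat: "csat S (full_diag S U) \<chi> \<gamma>" and x: "x \<in> cfree \<gamma>" and y: "y \<in> cfree \<gamma>"
  shows "\<chi> x = \<chi> y"
proof -
  obtain zs \<beta> A \<alpha> where \<gamma>: "\<gamma> = cexs zs \<beta>" and \<beta>: "conj_of_atoms A \<beta>"
    and \<alpha>: "\<alpha> \<in> A" "x \<in> cfree \<alpha>" "y \<in> cfree \<alpha>"
    using clique x y by (fastforce simp: clique_formula_def)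
  obtain \<chi>' where \<chi>': "\<And>x. x \<notin> set zs \<Longrightarrow> \<chi>' x = \<chi> x" "csat S (full_diag S U) \<chi>' \<beta>"
    using sat unfolding \<gamma> csat_cexs by blast
  have "\<chi>' x = \<chi>' y"
    using S is_atom_conj_of_atoms [OF \<beta> \<alpha>(1)] _ _ \<alpha>(2,3)
    by (rule csat_full_diag_atomD [where U = U])
      (use cover \<chi>'(2) \<alpha>(1) in \<open>auto simp: \<gamma> cover_sig_conj_of_atoms [OF \<beta>] csat_conj_of_atoms [OF \<beta>]\<close>)
  then show ?thesis
    using \<chi>'(1) x y \<gamma> by simp
qed

section \<open>Invariance of the clique-guarded and guarded-negation fragments\<close>

text \<open>The guard admits only constant assignments and holds under all of them, so only the body
  has to be transferred. One direction for an arbitrary body suffices: exchanging the universes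
  gives the converse, and a negated body gives universal blocks.\<close>

lemma csat_full_diag_guarded_block:
  assumes S: "wf_signature S" and clique: "clique_formula \<gamma>" and cover: "cover_sig S \<gamma>"
    and ys: "set ys \<subseteq> cfree \<gamma>"
    and body: "\<And>\<chi> \<chi>' c c'. c \<in> U \<Longrightarrow> c' \<in> U' \<Longrightarrow> const_on \<chi> c (cfree \<gamma>) \<Longrightarrow>
      const_on \<chi>' c' (cfree \<gamma>) \<Longrightarrow> csat S (full_diag S U) \<chi> \<phi> \<Longrightarrow> csat S (full_diag S U') \<chi>' \<phi>"
    and c: "c \<in> U" "const_on \<chi> c (cfree \<gamma> - set ys)"
    and c': "c' \<in> U'" "const_on \<chi>' c' (cfree \<gamma> - set ys)"
    and sat: "csat S (full_diag S U) \<chi> (cexs ys (CAnd \<gamma> \<phi>))"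
  shows "csat S (full_diag S U') \<chi>' (cexs ys (CAnd \<gamma> \<phi>))"
proof -
  obtain \<chi>1 where \<chi>1: "\<And>x. x \<notin> set ys \<Longrightarrow> \<chi>1 x = \<chi> x" "\<And>y. y \<in> set ys \<Longrightarrow> \<chi>1 y \<in> Some ` U"
      "csat S (full_diag S U) \<chi>1 \<gamma>" "csat S (full_diag S U) \<chi>1 \<phi>"
    using sat unfolding csat_cexs by auto
  \<comment> \<open>A guard variable outside \<open>ys\<close> pins \<open>d\<close> to
    \<open>c\<close>. If the block binds all guard variables, \<open>d\<close> may be another point,
    hence the generality of \<open>body\<close>. For a guard without free variables \<open>c\<close>
    itself serves.\<close>
  have "\<exists>d\<in>U. const_on \<chi>1 d (cfree \<gamma>)"
  proof (cases "cfree \<gamma> = {}")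
    case True
    then show ?thesis using c by (auto simp: const_on_def)
  next
    case False
    then obtain x where x: "x \<in> cfree \<gamma>" by blast
    then have "\<chi>1 x \<in> Some ` U"
      using \<chi>1(1,2) c by (cases "x \<in> set ys") (auto simp: const_on_def)
    then show ?thesis
      using csat_full_diag_cliqueD [OF S clique cover \<chi>1(3) _ x] by (auto simp: const_on_def)
  qed
  then obtain d where d: "d \<in> U" "const_on \<chi>1 d (cfree \<gamma>)" by blast
  \<comment> \<open>Block variables get the value \<open>c'\<close> of the remaining guard
    variables, which makes the assignment constant on the whole guard.\<close>
  define \<chi>1' where "\<chi>1' x = (if x \<in> set ys then Some c' else \<chi>' x)" for x
  have const: "const_on \<chi>1' c' (cfree \<gamma>)"
    using c' by (auto simp: const_on_def \<chi>1'_def)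
  have "csat S (full_diag S U') \<chi>1' (CAnd \<gamma> \<phi>)"
    using csat_full_diag_clique [OF S clique cover const c'(1)]
      body [OF d(1) c'(1) d(2) const \<chi>1(4)] by simp
  then show ?thesis
    using c' unfolding csat_cexs by (intro exI [of _ \<chi>1']) (auto simp: \<chi>1'_def)
qed

text \<open>A guarded quantifier leads from constant assignments to constant assignments only, so
  neither the size of the universe nor the choice of the value is detected. The values are
  generalised in the induction because a block may replace them.\<close>

lemma cgfol_full_diag_iff:
  assumes S: "wf_signature S"
  shows "guarded_by clique_formula \<psi> \<Longrightarrow> cover_sig S \<psi> \<Longrightarrow>
    c \<in> U \<Longrightarrow> const_on \<chi> c (cfree \<psi>) \<Longrightarrow> c' \<in> U' \<Longrightarrow> const_on \<chi>' c' (cfree \<psi>) \<Longrightarrow>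
    csat S (full_diag S U) \<chi> \<psi> \<longleftrightarrow> csat S (full_diag S U') \<chi>' \<psi>"
proof (induction arbitrary: c c' \<chi> \<chi>' rule: guarded_by.induct)
  case (1 \<alpha>)
  then show ?case
    using csat_full_diag_atom [OF S, of \<alpha> \<chi> c U] csat_full_diag_atom [OF S, of \<alpha> \<chi>' c' U'] by simp
next
  case (2 \<phi>)
  then show ?case
    using "2.IH" [of c \<chi> c' \<chi>'] by simp
next
  case (3 \<phi> \<psi>)
  show ?case
    using "3.IH"(1) [of c \<chi> c' \<chi>'] "3.IH"(2) [of c \<chi> c' \<chi>'] "3.prems" by simp
next
  case (4 \<phi> \<psi>)
  show ?case
    using "4.IH"(1) [of c \<chi> c' \<chi>'] "4.IH"(2) [of c \<chi> c' \<chi>'] "4.prems" by simp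
next
  case (5 \<phi> \<psi>)
  show ?case
    using "5.IH"(1) [of c \<chi> c' \<chi>'] "5.IH"(2) [of c \<chi> c' \<chi>'] "5.prems" by simp
next
  case (6 \<gamma> ys \<phi>)
  have cover: "cover_sig S \<gamma>" "cover_sig S \<phi>" and const: "const_on \<chi> c (cfree \<gamma> - set ys)"
      "const_on \<chi>' c' (cfree \<gamma> - set ys)"
    using "6.prems" by (auto simp: const_on_def)
  have body: "csat S (full_diag S U) \<chi> \<phi> \<longleftrightarrow> csat S (full_diag S U') \<chi>' \<phi>"
    if "c \<in> U" "c' \<in> U'" "const_on \<chi> c (cfree \<gamma>)" "const_on \<chi>' c' (cfree \<gamma>)" for c c' \<chi> \<chi>'
    by (rule "6.IH"
        [OF cover(2) that(1) const_on_subset [OF that(3)] that(2) const_on_subset [OF that(4)]])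
      (rule "6.hyps"(3))+
  note block = csat_full_diag_guarded_block [OF S \<open>clique_formula \<gamma>\<close> cover(1) \<open>set ys \<subseteq> cfree \<gamma>\<close>]
  show ?case
  proof
    show "csat S (full_diag S U') \<chi>' (cexs ys (CAnd \<gamma> \<phi>))"
      if "csat S (full_diag S U) \<chi> (cexs ys (CAnd \<gamma> \<phi>))"
      by (rule block [OF _ \<open>c \<in> U\<close> const(1) \<open>c' \<in> U'\<close> const(2) that]) (rule iffD1 [OF body]; assumption)
    show "csat S (full_diag S U) \<chi> (cexs ys (CAnd \<gamma> \<phi>))"
      if "csat S (full_diag S U') \<chi>' (cexs ys (CAnd \<gamma> \<phi>))"
      by (rule block [OF _ \<open>c' \<in> U'\<close> const(2) \<open>c \<in> U\<close> const(1) that]) (rule iffD2 [OF body]; assumption)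
  qed
next
  case (7 \<gamma> ys \<phi>)
  have cover: "cover_sig S \<gamma>" "cover_sig S \<phi>" and const: "const_on \<chi> c (cfree \<gamma> - set ys)"
      "const_on \<chi>' c' (cfree \<gamma> - set ys)"
    using "7.prems" by (auto simp: const_on_def)
  \<comment> \<open>A universal block negates an existential one with the same guard and the negated
    body, so \<open>CNeg \<phi>\<close> is what has to transfer.\<close>
  have body: "csat S (full_diag S U) \<chi> (CNeg \<phi>) \<longleftrightarrow> csat S (full_diag S U') \<chi>' (CNeg \<phi>)"
    if "c \<in> U" "c' \<in> U'" "const_on \<chi> c (cfree \<gamma>)" "const_on \<chi>' c' (cfree \<gamma>)" for c c' \<chi> \<chi>'
    unfolding csat.simps(3)
    by (rule arg_cong [where f = Not], rule "7.IH"
        [OF cover(2) that(1) const_on_subset [OF that(3)] that(2) const_on_subset [OF that(4)]])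
      (rule "7.hyps"(3))+
  note block = csat_full_diag_guarded_block [OF S \<open>clique_formula \<gamma>\<close> cover(1) \<open>set ys \<subseteq> cfree \<gamma>\<close>]
  have "csat S (full_diag S U) \<chi> (cexs ys (CAnd \<gamma> (CNeg \<phi>))) \<longleftrightarrow>
      csat S (full_diag S U') \<chi>' (cexs ys (CAnd \<gamma> (CNeg \<phi>)))"
  proof
    show "csat S (full_diag S U') \<chi>' (cexs ys (CAnd \<gamma> (CNeg \<phi>)))"
      if "csat S (full_diag S U) \<chi> (cexs ys (CAnd \<gamma> (CNeg \<phi>)))"
      by (rule block [OF _ \<open>c \<in> U\<close> const(1) \<open>c' \<in> U'\<close> const(2) that]) (rule iffD1 [OF body]; assumption)
    show "csat S (full_diag S U) \<chi> (cexs ys (CAnd \<gamma> (CNeg \<phi>)))"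
      if "csat S (full_diag S U') \<chi>' (cexs ys (CAnd \<gamma> (CNeg \<phi>)))"
      by (rule block [OF _ \<open>c' \<in> U'\<close> const(2) \<open>c \<in> U\<close> const(1) that]) (rule iffD2 [OF body]; assumption)
  qed
  \<comment> \<open>After \<open>csat_calls\<close> the matrix is
    \<open>CNeg (CImp \<gamma> \<phi>)\<close>, which has the truth value of
    \<open>CAnd \<gamma> (CNeg \<phi>)\<close>.\<close>
  then show ?case
    by (simp add: csat_calls csat_cexs)
qed

text \<open>The two directions must be proved together: a guarded negation turns one into the other.\<close>

lemma gnfol_full_diag:
  assumes S: "wf_signature S" and U: "U \<noteq> {}"
  shows "gnfol \<psi> \<Longrightarrow> cover_sig S \<psi> \<Longrightarrow> const_on \<chi>' e (cfree \<psi>) \<Longrightarrow>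
    (\<chi> ` cfree \<psi> \<subseteq> Some ` U \<longrightarrow>
       csat S (full_diag S U) \<chi> \<psi> \<longrightarrow> csat S (full_diag S {e}) \<chi>' \<psi>) \<and>
    (\<forall>c\<in>U. const_on \<chi> c (cfree \<psi>) \<longrightarrow>
       csat S (full_diag S {e}) \<chi>' \<psi> \<longrightarrow> csat S (full_diag S U) \<chi> \<psi>)"
proof (induction arbitrary: \<chi> \<chi>' rule: gnfol.induct)
  case (1 r xs)
  then show ?case
    using csat_full_diag_atom [OF S, of "CRel r xs" \<chi>' e "{e}"]
      csat_full_diag_atom [OF S, of "CRel r xs" \<chi> _ U] by (simp del: csat.simps)
next
  case (2 x y)
  then show ?case by (auto simp: const_on_def)
next
  case (3 \<phi> x)
  have const': "const_on (\<chi>'(x \<mapsto> e)) e (cfree \<phi>)"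
    using 3 by (simp add: const_on_def)
  have IH: "\<chi> ` cfree \<phi> \<subseteq> Some ` U \<Longrightarrow> csat S (full_diag S U) \<chi> \<phi> \<Longrightarrow>
      csat S (full_diag S {e}) (\<chi>'(x \<mapsto> e)) \<phi>"
    "c \<in> U \<Longrightarrow> const_on \<chi> c (cfree \<phi>) \<Longrightarrow> csat S (full_diag S {e}) (\<chi>'(x \<mapsto> e)) \<phi> \<Longrightarrow>
      csat S (full_diag S U) \<chi> \<phi>" for \<chi> c
    using "3.IH" [OF _ const', of \<chi>] "3.prems"(1) unfolding cover_sig.simps by blast+
  show ?case
  proof (intro conjI impI ballI)
    assume range: "\<chi> ` cfree (CEx x \<phi>) \<subseteq> Some ` U" and "csat S (full_diag S U) \<chi> (CEx x \<phi>)"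
    then obtain d where d: "d \<in> U" "csat S (full_diag S U) (\<chi>(x \<mapsto> d)) \<phi>" by auto
    \<comment> \<open>The unguarded witness \<open>d\<close> may differ from the other values of
      \<open>\<chi>\<close>; this direction therefore asks only that the values lie in
      \<open>U\<close>, not that they coincide.\<close>
    have "(\<chi>(x \<mapsto> d)) ` cfree \<phi> \<subseteq> Some ` U"
      using range d(1) by auto
    from IH(1) [OF this d(2)] show "csat S (full_diag S {e}) \<chi>' (CEx x \<phi>)"
      by simp
  next
    fix c
    assume c: "c \<in> U" "const_on \<chi> c (cfree (CEx x \<phi>))"
      and sat: "csat S (full_diag S {e}) \<chi>' (CEx x \<phi>)"
    \<comment> \<open>In this direction the witness can be chosen: reusing \<open>c\<close> keeps
      the assignment constant.\<close>
    have "const_on (\<chi>(x \<mapsto> c)) c (cfree \<phi>)"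
      using c by (simp add: const_on_def)
    with c sat show "csat S (full_diag S U) \<chi> (CEx x \<phi>)"
      by (auto intro: IH(2))
  qed
next
  case (4 \<phi> \<psi>)
  have "const_on \<chi>' e (cfree \<phi>)" "const_on \<chi>' e (cfree \<psi>)" "cover_sig S \<phi>" "cover_sig S \<psi>"
    using "4.prems" by (auto simp: const_on_def)
  with "4.IH"(1) [of \<chi>' \<chi>] "4.IH"(2) [of \<chi>' \<chi>] show ?case
    by (auto simp: const_on_def image_Un)
next
  case (5 \<phi> \<psi>)
  have "const_on \<chi>' e (cfree \<phi>)" "const_on \<chi>' e (cfree \<psi>)" "cover_sig S \<phi>" "cover_sig S \<psi>"
    using "5.prems" by (auto simp: const_on_def)
  with "5.IH"(1) [of \<chi>' \<chi>] "5.IH"(2) [of \<chi>' \<chi>] show ?case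
    by (auto simp: const_on_def image_Un)
next
  case (6 \<alpha> \<phi>)
  have cover: "cover_sig S \<alpha>" "cover_sig S \<phi>" and const: "const_on \<chi>' e (cfree \<alpha>)"
    and const_\<phi>: "const_on \<chi>' e (cfree \<phi>)"
    using 6 by (auto simp: const_on_def)
  have IH: "\<chi> ` cfree \<phi> \<subseteq> Some ` U \<Longrightarrow> csat S (full_diag S U) \<chi> \<phi> \<Longrightarrow>
      csat S (full_diag S {e}) \<chi>' \<phi>"
    "c \<in> U \<Longrightarrow> const_on \<chi> c (cfree \<phi>) \<Longrightarrow> csat S (full_diag S {e}) \<chi>' \<phi> \<Longrightarrow>
      csat S (full_diag S U) \<chi> \<phi>" for c
    using "6.IH" [OF cover(2) const_\<phi>] by auto
  show ?case
  proof (intro conjI impI ballI)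
    assume range: "\<chi> ` cfree (CAnd \<alpha> (CNeg \<phi>)) \<subseteq> Some ` U"
      and sat: "csat S (full_diag S U) \<chi> (CAnd \<alpha> (CNeg \<phi>))"
    have eq: "\<chi> x = \<chi> y" if "x \<in> cfree \<alpha>" "y \<in> cfree \<alpha>" for x y
      using sat
      by (intro csat_full_diag_atomD [OF S \<open>is_atom \<alpha>\<close> cover(1) _ that, where U = U]) simp
    \<comment> \<open>The guard makes an arbitrary assignment constant, so that the converse
      direction of the induction hypothesis, contraposed, applies to the negated formula.\<close>
    have "\<exists>c\<in>U. const_on \<chi> c (cfree \<alpha>)"
    proof (cases "cfree \<alpha> = {}")
      case True
      then show ?thesis using U by (auto simp: const_on_def)
    next
      case False
      then obtain x c where "x \<in> cfree \<alpha>" "\<chi> x = Some c" "c \<in> U" using range by fastforce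
      then show ?thesis using eq by (metis const_on_def)
    qed
    then obtain c where "c \<in> U" "const_on \<chi> c (cfree \<phi>)"
      by (meson "6.hyps"(2) const_on_subset)
    with sat IH(2) have "\<not> csat S (full_diag S {e}) \<chi>' \<phi>" by auto
    then show "csat S (full_diag S {e}) \<chi>' (CAnd \<alpha> (CNeg \<phi>))"
      using csat_full_diag_atom [OF S \<open>is_atom \<alpha>\<close> cover(1) const] by simp
  next
    fix c
    assume c: "c \<in> U" "const_on \<chi> c (cfree (CAnd \<alpha> (CNeg \<phi>)))"
      and sat: "csat S (full_diag S {e}) \<chi>' (CAnd \<alpha> (CNeg \<phi>))"
    have "\<chi> ` cfree \<phi> \<subseteq> Some ` U" "const_on \<chi> c (cfree \<alpha>)"
      using c by (auto simp: const_on_def)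
    then show "csat S (full_diag S U) \<chi> (CAnd \<alpha> (CNeg \<phi>))"
      using IH(1) sat csat_full_diag_atom [OF S \<open>is_atom \<alpha>\<close> cover(1) _ c(1)] by auto
  qed
qed

section \<open>Invariance of the one-binding fragment\<close>

text \<open>Invariance under isomorphism, where \<open>\<pi>\<close> has to respect only the
  relations occurring in \<open>\<phi>\<close>. Injectivity is required on the whole type since
  \<open>\<chi>\<close> may take values outside \<open>U\<close>.\<close>

lemma sat_diag_permute:
  assumes "inj \<pi>" "\<pi> ` U = U" "\<And>r. r \<in> set2_fml \<phi> \<Longrightarrow> D' r = \<pi> ` D r"
  shows "sat S (diag S U D') (map_option \<pi> \<circ> \<chi>) \<phi> \<longleftrightarrow> sat S (diag S U D) \<chi> \<phi>"
proof -
  have upd: "(map_option \<pi> \<circ> \<chi>)(i \<mapsto> \<pi> d) = map_option \<pi> \<circ> \<chi>(i \<mapsto> d)" for \<chi> i d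
    by auto
  show ?thesis
    using assms(3)
  proof (induction \<phi> arbitrary: \<chi>)
    case (Rel r)
    have "map_option \<pi> v = Some (\<pi> d) \<longleftrightarrow> v = Some d" for v d
      using \<open>inj \<pi>\<close> by (cases v) (auto dest: injD)
    then show ?case
      using Rel by (simp add: sat_diag_Rel del: sat.simps(1))
  next
    case (Ex x \<phi>)
    \<comment> \<open>Writing the universe as its own image gives every witness the form
      \<open>\<pi> d\<close>, which \<open>upd\<close> moves inside the composition.\<close>
    have "sat S (diag S U D') (map_option \<pi> \<circ> \<chi>) (Ex x \<phi>) \<longleftrightarrow>
        (\<exists>d\<in>\<pi> ` U. sat S (diag S U D') ((map_option \<pi> \<circ> \<chi>)(Inr x \<mapsto> d)) \<phi>)"
      by (simp only: sat.simps universe_diag assms(2))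
    also have "\<dots> \<longleftrightarrow> (\<exists>d\<in>U. sat S (diag S U D') (map_option \<pi> \<circ> \<chi>(Inr x \<mapsto> d)) \<phi>)"
      by (simp only: bex_simps(7) upd)
    also have "\<dots> \<longleftrightarrow> (\<exists>d\<in>U. sat S (diag S U D) (\<chi>(Inr x \<mapsto> d)) \<phi>)"
      by (intro bex_cong refl Ex.IH) (simp add: Ex.prems)
    finally show ?case
      unfolding sat.simps universe_diag .
  next
    case (All x \<phi>)
    have "sat S (diag S U D') (map_option \<pi> \<circ> \<chi>) (All x \<phi>) \<longleftrightarrow>
        (\<forall>d\<in>\<pi> ` U. sat S (diag S U D') ((map_option \<pi> \<circ> \<chi>)(Inr x \<mapsto> d)) \<phi>)"
      by (simp only: sat.simps universe_diag assms(2))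
    also have "\<dots> \<longleftrightarrow> (\<forall>d\<in>U. sat S (diag S U D') (map_option \<pi> \<circ> \<chi>(Inr x \<mapsto> d)) \<phi>)"
      by (simp only: ball_simps(9) upd)
    also have "\<dots> \<longleftrightarrow> (\<forall>d\<in>U. sat S (diag S U D) (\<chi>(Inr x \<mapsto> d)) \<phi>)"
      by (intro ball_cong refl All.IH) (simp add: All.prems)
    finally show ?case
      unfolding sat.simps universe_diag .
  next
    case (Bind a x \<phi>)
    have "map_option \<pi> \<circ> \<chi>(Inl a := \<chi> (Inr x)) =
        (map_option \<pi> \<circ> \<chi>)(Inl a := (map_option \<pi> \<circ> \<chi>) (Inr x))"
      by auto
    then have "sat S (diag S U D') (map_option \<pi> \<circ> \<chi>) (Bind a x \<phi>) \<longleftrightarrow>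
        sat S (diag S U D') (map_option \<pi> \<circ> \<chi>(Inl a := \<chi> (Inr x))) \<phi>"
      by (simp only: sat.simps)
    also have "\<dots> \<longleftrightarrow> sat S (diag S U D) (\<chi>(Inl a := \<chi> (Inr x))) \<phi>"
      by (rule Bind.IH) (simp add: Bind.prems)
    finally show ?case
      unfolding sat.simps .
  qed auto
qed

lemma derived_rel_ar: "derived_rel S A \<rho> \<Longrightarrow> r \<in> set2_fml \<rho> \<Longrightarrow> ar S r = A"
  by (induction rule: derived_rel.induct) auto

lemma set2_fml_quant_prefix [simp]: "set2_fml (quant_prefix qs \<phi>) = set2_fml \<phi>"
proof (induction qs)
  case (Cons q qs)
  then show ?case by (cases q; cases "fst q") (auto simp: quant_prefix_def)
qed (simp add: quant_prefix_def)

lemma set2_fml_bind_prefix [simp]: "set2_fml (bind_prefix bs \<phi>) = set2_fml \<phi>"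
proof (induction bs)
  case (Cons b bs)
  then show ?case by (cases b) (simp add: bind_prefix_def)
qed (simp add: bind_prefix_def)

text \<open>Each quantified block mentions relations of one argument set \<open>A\<close> only and
  is invariant under the permutation chosen for \<open>A\<close>. Blocks are combined by conjunction
  and disjunction of truth values, so different blocks may use different permutations.\<close>

lemma obfol_diag_iff:
  assumes "obfol S \<phi>"
    and "\<And>A. \<exists>\<pi>. inj \<pi> \<and> \<pi> ` U = U \<and> (\<forall>r. ar S r = A \<longrightarrow> D' r = \<pi> ` D r)"
  shows "models S (diag S U D') \<phi> \<longleftrightarrow> models S (diag S U D) \<phi>"
  using assms(1)
proof (induction rule: obfol.induct)
  case (1 qs bs A \<rho>)
  obtain \<pi> where \<pi>: "inj \<pi>" "\<pi> ` U = U" "\<And>r. ar S r = A \<Longrightarrow> D' r = \<pi> ` D r"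
    using assms(2) [of A] by blast
  have "D' r = \<pi> ` D r" if "r \<in> set2_fml (quant_prefix qs (bind_prefix bs \<rho>))" for r
    using that derived_rel_ar [OF 1(4)] \<pi>(3) by simp
  \<comment> \<open>The empty assignment is unchanged by composing with
    \<open>\<pi>\<close>.\<close>
  from sat_diag_permute [OF \<pi>(1,2) this, where \<phi> = "quant_prefix qs (bind_prefix bs \<rho>)"
      and \<chi> = Map.empty] show ?case
    by (simp add: models_def comp_def)
qed (simp_all add: models_def)

section \<open>The separating sentences\<close>

text \<open>Relation \<open>0\<close> is unary and relation \<open>1\<close> binary. They share an
  argument, but their argument sets differ, which bars an OBFOL matrix from mentioning both.\<close>

definition sep_sig :: "(nat, nat) signature" where
  "sep_sig = \<lparr>args = {0, 1}, rels = {0, 1}, ar = (\<lambda>r. if r = 0 then {0} else {0, 1})\<rparr>"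

definition total_fml :: "(nat, nat) fml" where
  "total_fml = quant_prefix [(Forall, 0), (Forall, 1)] (bind_prefix [(0, 0), (1, 1)] (Rel 1))"

text \<open>The first conjunct guards the quantifier and no negation occurs, which places the
  sentence in the guarded and in the guarded-negation fragment.\<close>

definition loop_fml :: "nat cfml" where
  "loop_fml = CEx 0 (CAnd (CRel 0 [0]) (CRel 1 [0, 0]))"

lemma sep_sig_simps [simp]:
  "args sep_sig = {0, 1}" "rels sep_sig = {0, 1}" "ar sep_sig r = (if r = 0 then {0} else {0, 1})"
  by (simp_all add: sep_sig_def)

lemma wf_sep_sig: "wf_signature sep_sig"
  by (simp add: wf_signature_def)

section \<open>Totality of a binary relation escapes both guarded fragments\<close>

lemma obfol_total_fml: "obfol sep_sig total_fml"
  unfolding total_fml_def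
  by (rule obfol.intros(1) [where A = "{0, 1}"]) (auto intro: derived_rel.intros)

lemma sentence_total_fml: "sentence sep_sig total_fml"
  by (auto simp: sentence_def total_fml_def quant_prefix_def bind_prefix_def)

lemma models_total_fml:
  "models sep_sig (full_diag sep_sig U) total_fml \<longleftrightarrow> (\<forall>d\<in>U. \<forall>d'\<in>U. d = d')"
  by (auto simp: models_def total_fml_def quant_prefix_def bind_prefix_def sat_diag_Rel
      simp del: sat.simps(1))

lemma total_fml_not_equivalent:
  assumes "cmodels sep_sig (full_diag sep_sig {0::nat}) \<psi> \<longleftrightarrow>
    cmodels sep_sig (full_diag sep_sig {0::nat, 1}) \<psi>"
  shows "\<not> equivalent TYPE(nat) sep_sig total_fml \<psi>"
proof
  assume equiv: "equivalent TYPE(nat) sep_sig total_fml \<psi>"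
  have "is_structure sep_sig (full_diag sep_sig {0::nat})"
    "is_structure sep_sig (full_diag sep_sig {0::nat, 1})"
    by (simp_all add: is_structure_diag)
  with equiv assms show False
    using models_total_fml [of "{0::nat}"] models_total_fml [of "{0::nat, 1}"]
    by (auto simp: equivalent_def)
qed

lemma total_fml_not_cgfol:
  assumes "cgfol \<psi>" "csentence sep_sig \<psi>"
  shows "\<not> equivalent TYPE(nat) sep_sig total_fml \<psi>"
  \<comment> \<open>A sentence has no free variables, so any common value will do; \<open>0\<close>
    lies in both universes.\<close>
  by (rule total_fml_not_equivalent, unfold cmodels_def,
      rule cgfol_full_diag_iff [OF wf_sep_sig, where c = 0 and c' = 0])
    (use assms in \<open>auto simp: cgfol_def csentence_def const_on_def\<close>)

lemma total_fml_not_gnfol: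
  assumes "gnfol \<psi>" "csentence sep_sig \<psi>"
  shows "\<not> equivalent TYPE(nat) sep_sig total_fml \<psi>"
  \<comment> \<open>With \<open>e = 0\<close> and empty assignments, the two halves are the two
    directions between \<open>{0, 1}\<close> and \<open>{0}\<close>.\<close>
  using gnfol_full_diag [OF wf_sep_sig _ assms(1), of "{0, 1}" Map.empty 0 Map.empty] assms(2)
  by (intro total_fml_not_equivalent)
    (auto simp: cmodels_def csentence_def const_on_def simp del: One_nat_def)

section \<open>A guarded loop escapes the one-binding fragment\<close>

lemma csentence_loop_fml: "csentence sep_sig loop_fml"
  by (simp add: csentence_def loop_fml_def)

lemma equality_free_loop_fml: "equality_free loop_fml"
  by (simp add: loop_fml_def)

lemma gfol_loop_fml: "gfol loop_fml"
proof -
  have loop: "loop_fml = cexs [0] (CAnd (CRel 0 [0]) (CRel 1 [0, 0]))"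
    by (simp add: loop_fml_def cexs_def)
  show ?thesis
    unfolding gfol_def loop by (intro guarded_by.intros) simp_all
qed

lemma gnfol_loop_fml: "gnfol loop_fml"
  unfolding loop_fml_def by (intro gnfol.intros)

lemma cmodels_loop_fml:
  "cmodels sep_sig (diag sep_sig U D) loop_fml \<longleftrightarrow> U \<inter> D 0 \<inter> D 1 \<noteq> {}"
  by (auto simp: cmodels_def loop_fml_def csat_diag_CRel wf_sep_sig simp del: csat.simps(1))

lemma loop_fml_not_obfol:
  assumes "obfol sep_sig \<phi>"
  shows "\<not> equivalent TYPE(nat) sep_sig \<phi> loop_fml"
proof
  assume equiv: "equivalent TYPE(nat) sep_sig \<phi> loop_fml"
  \<comment> \<open>For \<open>c = 0\<close> both relations hold at one point, for
    \<open>c = 1\<close> at different points. All \<open>r\<close> other than \<open>0\<close> are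
    treated alike because \<open>obfol_diag_iff\<close> compares every \<open>r\<close> with a given
    argument set, also outside the signature.\<close>
  define D :: "nat \<Rightarrow> nat \<Rightarrow> nat set" where "D c r = (if r = 0 then {0} else {c})" for c r
  \<comment> \<open>Fixing the numbers from \<open>2\<close> on makes the transposition injective on
    the whole type.\<close>
  define swap :: "nat \<Rightarrow> nat" where "swap d = (if d = 0 then 1 else if d = 1 then 0 else d)" for d
  have "is_structure sep_sig (diag sep_sig {0, 1} (D 0))"
    "is_structure sep_sig (diag sep_sig {0, 1} (D 1))"
    by (auto simp: D_def intro!: is_structure_diag)
  moreover have "models sep_sig (diag sep_sig {0, 1} (D 1)) \<phi> \<longleftrightarrow>
      models sep_sig (diag sep_sig {0, 1} (D 0)) \<phi>"
  proof (rule obfol_diag_iff [OF assms])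
    fix A :: "nat set"
    have "inj swap" "swap ` {0, 1} = {0, 1}"
      by (auto simp: inj_def swap_def split: if_splits)
    \<comment> \<open>The unary relation stays at \<open>0\<close>, so the identity fits; every
      other relation moves from \<open>0\<close> to \<open>1\<close>, as the transposition
      does.\<close>
    then show "\<exists>\<pi>. inj \<pi> \<and> \<pi> ` {0, 1} = {0, 1} \<and> (\<forall>r. ar sep_sig r = A \<longrightarrow> D 1 r = \<pi> ` D 0 r)"
      by (intro exI [of _ "if A = {0} then id else swap"]) (auto simp: D_def swap_def)
  qed
  moreover have "cmodels sep_sig (diag sep_sig {0, 1} (D 0)) loop_fml"
    "\<not> cmodels sep_sig (diag sep_sig {0, 1} (D 1)) loop_fml"
    by (simp_all add: cmodels_loop_fml D_def)
  ultimately show False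
    using equiv by (auto simp: equivalent_def)
qed

theorem mainTheorem6:
  shows "\<exists>S :: (nat, nat) signature. wf_signature S \<and>
    (\<exists>\<phi>. obfol S \<phi> \<and> sentence S \<phi> \<and>
       (\<forall>\<psi>. cgfol \<psi> \<and> csentence S \<psi> \<longrightarrow> \<not> equivalent TYPE(nat) S \<phi> \<psi>) \<and>
       (\<forall>\<psi>. gnfol \<psi> \<and> csentence S \<psi> \<longrightarrow> \<not> equivalent TYPE(nat) S \<phi> \<psi>)) \<and>
    (\<exists>\<psi>. csentence S \<psi> \<and> equality_free \<psi> \<and> gfol \<psi> \<and> cgfol \<psi> \<and> gnfol \<psi> \<and>
       (\<forall>\<phi>. obfol S \<phi> \<and> sentence S \<phi> \<longrightarrow> \<not> equivalent TYPE(nat) S \<phi> \<psi>))"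
proof -
  have "\<exists>\<phi>. obfol sep_sig \<phi> \<and> sentence sep_sig \<phi> \<and>
      (\<forall>\<psi>. cgfol \<psi> \<and> csentence sep_sig \<psi> \<longrightarrow> \<not> equivalent TYPE(nat) sep_sig \<phi> \<psi>) \<and>
      (\<forall>\<psi>. gnfol \<psi> \<and> csentence sep_sig \<psi> \<longrightarrow> \<not> equivalent TYPE(nat) sep_sig \<phi> \<psi>)"
    using obfol_total_fml sentence_total_fml total_fml_not_cgfol total_fml_not_gnfol by blast
  moreover have "\<exists>\<psi>. csentence sep_sig \<psi> \<and> equality_free \<psi> \<and> gfol \<psi> \<and> cgfol \<psi> \<and> gnfol \<psi> \<and>
      (\<forall>\<phi>. obfol sep_sig \<phi> \<and> sentence sep_sig \<phi> \<longrightarrow> \<not> equivalent TYPE(nat) sep_sig \<phi> \<psi>)"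
    using csentence_loop_fml equality_free_loop_fml gfol_loop_fml gfol_imp_cgfol gnfol_loop_fml
      loop_fml_not_obfol by blast
  ultimately show ?thesis
    using wf_sep_sig by blast
qed

end
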